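(* Let $S$ be a regular AG-band and let $A=(\mu_A,\gamma_A)$ be an intuitionistic fuzzy set of $S$. If $A$ is an intuitionistic fuzzy $(1,2)$-ideal of $S$, then $A$ is an intuitionistic fuzzy right ideal of $S$.
   Context: An AG-groupoid is a non-empty set $S$ with a binary operation satisfying the left invertive law $(ab)c=(cb)a$ for all $a,b,c\in S$ (no associativity is assumed). $S$ is an AG-band if $aa=a$ for all $a\in S$. $S$ is regular if for every $a\in S$ there is $x\in S$ with $a=(ax)a$. An intuitionistic fuzzy set (IFS) of $S$ is a pair $A=(\mu_A,\gamma_A)$ of functions $\mu_A,\gamma_A:S\to[0,1]$ with $0\le \mu_A(x)+\gamma_A(x)\le 1$ for all $x\in S$. An IFS $A$ is an intuitionistic fuzzy right ideal if $\mu_A(xy)\ge\mu_A(x)$ and $\gamma_A(xy)\le\gamma_A(x)$ for all $x,y\in S$. It is an intuitionistic fuzzy AG-subgroupoid if $\mu_A(xy)\ge\min\{\mu_A(x),\mu_A(y)\}$ and $\gamma_A(xy)\le\max\{\gamma_A(x),\gamma_A(y)\}$ for all $x,y\in S$. An intuitionistic fuzzy $(1,2)$-ideal is an intuitionistic fuzzy AG-subgroupoid with $\mu_A((xw)(yz))\ge\min\{\mu_A(x),\mu_A(y),\mu_A(z)\}$ and $\gamma_A((xw)(yz))\le\max\{\gamma_A(x),\gamma_A(y),\gamma_A(z)\}$ for all $x,w,y,z\in S$. *)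

theory Defs
  imports Complex_Main "HOL-Library.FuncSet"
begin

locale ag_groupoid =
  fixes S :: "'a set" and mult :: "'a \<Rightarrow> 'a \<Rightarrow> 'a" (infixl "\<cdot>" 70)
  assumes nonempty: "S \<noteq> {}"
    and closed: "\<lbrakk>a \<in> S; b \<in> S\<rbrakk> \<Longrightarrow> a \<cdot> b \<in> S"
    and left_invertive: "\<lbrakk>a \<in> S; b \<in> S; c \<in> S\<rbrakk> \<Longrightarrow> (a \<cdot> b) \<cdot> c = (c \<cdot> b) \<cdot> a"

locale ag_band = ag_groupoid +
  assumes idem: "a \<in> S \<Longrightarrow> a \<cdot> a = a"

locale regular_ag_groupoid = ag_groupoid +
  assumes regular: "a \<in> S \<Longrightarrow> \<exists>x\<in>S. a = (a \<cdot> x) \<cdot> a"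

locale regular_ag_band = ag_band + regular_ag_groupoid

text \<open>Membership and non-membership degrees are real-valued functions of which only the
  values on the carrier matter.\<close>

definition intuitionistic_fuzzy_set :: "'a set \<Rightarrow> ('a \<Rightarrow> real) \<Rightarrow> ('a \<Rightarrow> real) \<Rightarrow> bool" where
  "intuitionistic_fuzzy_set S \<mu> \<gamma> \<longleftrightarrow>
     \<mu> \<in> S \<rightarrow> {0..1} \<and> \<gamma> \<in> S \<rightarrow> {0..1} \<and>
     (\<forall>x\<in>S. 0 \<le> \<mu> x + \<gamma> x \<and> \<mu> x + \<gamma> x \<le> 1)"

context ag_groupoid
begin

definition if_right_ideal :: "('a \<Rightarrow> real) \<Rightarrow> ('a \<Rightarrow> real) \<Rightarrow> bool" where
  "if_right_ideal \<mu> \<gamma> \<longleftrightarrow>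
     intuitionistic_fuzzy_set S \<mu> \<gamma> \<and>
     (\<forall>x\<in>S. \<forall>y\<in>S. \<mu> (x \<cdot> y) \<ge> \<mu> x \<and> \<gamma> (x \<cdot> y) \<le> \<gamma> x)"

definition if_ag_subgroupoid :: "('a \<Rightarrow> real) \<Rightarrow> ('a \<Rightarrow> real) \<Rightarrow> bool" where
  "if_ag_subgroupoid \<mu> \<gamma> \<longleftrightarrow>
     intuitionistic_fuzzy_set S \<mu> \<gamma> \<and>
     (\<forall>x\<in>S. \<forall>y\<in>S. \<mu> (x \<cdot> y) \<ge> min (\<mu> x) (\<mu> y) \<and> \<gamma> (x \<cdot> y) \<le> max (\<gamma> x) (\<gamma> y))"

definition if_12_ideal :: "('a \<Rightarrow> real) \<Rightarrow> ('a \<Rightarrow> real) \<Rightarrow> bool" where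
  "if_12_ideal \<mu> \<gamma> \<longleftrightarrow>
     if_ag_subgroupoid \<mu> \<gamma> \<and>
     (\<forall>x\<in>S. \<forall>w\<in>S. \<forall>y\<in>S. \<forall>z\<in>S.
        \<mu> ((x \<cdot> w) \<cdot> (y \<cdot> z)) \<ge> Min {\<mu> x, \<mu> y, \<mu> z} \<and>
        \<gamma> ((x \<cdot> w) \<cdot> (y \<cdot> z)) \<le> Max {\<gamma> x, \<gamma> y, \<gamma> z})"

end

end

theory Submission
  imports Defs
begin

text \<open>With \<open>p = (x y) x = (x y) (x x)\<close>, the medial law gives
  \<open>(p y) (p x) = p (y x) = ((x y) y) (x x) = (y x) x = x y\<close> in every AG-band. So two applications
  of the (1,2)-condition lead from \<open>x\<close> to \<open>x y\<close>.\<close>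

text \<open>Three uses of left invertivity: exchange the outer factors, rearrange the inner product
  \<open>(c \<cdot> d) \<cdot> b\<close>, then exchange the outer factors back.\<close>

lemma (in ag_groupoid) medial:
  assumes "a \<in> S" "b \<in> S" "c \<in> S" "d \<in> S"
  shows "(a \<cdot> b) \<cdot> (c \<cdot> d) = (a \<cdot> c) \<cdot> (b \<cdot> d)"
proof -
  have "(a \<cdot> b) \<cdot> (c \<cdot> d) = ((c \<cdot> d) \<cdot> b) \<cdot> a"
    using assms by (intro left_invertive) (simp_all add: closed)
  also have "\<dots> = ((b \<cdot> d) \<cdot> c) \<cdot> a"
    using assms left_invertive[of c d b] by simp
  also have "\<dots> = (a \<cdot> c) \<cdot> (b \<cdot> d)"
    using assms left_invertive[of "b \<cdot> d" c a] by (simp add: closed)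
  finally show ?thesis .
qed

lemma (in ag_band) mult_mult_right_self:
  assumes "x \<in> S" "y \<in> S"
  shows "(x \<cdot> y) \<cdot> y = y \<cdot> x"
  using assms left_invertive[of x y y] by (simp add: idem)

lemma (in ag_band) mult_eq_12_product:
  assumes "x \<in> S" "y \<in> S"
  defines "p \<equiv> (x \<cdot> y) \<cdot> (x \<cdot> x)"
  shows "(p \<cdot> y) \<cdot> (p \<cdot> x) = x \<cdot> y"
proof -
  have p: "p \<in> S" and p_eq: "p = (x \<cdot> y) \<cdot> x"
    using assms by (simp_all add: closed idem)
  have "(p \<cdot> y) \<cdot> (p \<cdot> x) = p \<cdot> (y \<cdot> x)"
    using assms(1,2) p medial[of p y p x] by (simp add: idem)
  also have "\<dots> = ((x \<cdot> y) \<cdot> y) \<cdot> (x \<cdot> x)"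
    unfolding p_eq using assms(1,2) by (intro medial) (simp_all add: closed)
  \<comment> \<open>\<open>mult_mult_right_self\<close> acts twice, with the roles of
    \<open>x\<close> and \<open>y\<close> swapped the second time:
    \<open>(x \<cdot> y) \<cdot> y = y \<cdot> x\<close>, then
    \<open>(y \<cdot> x) \<cdot> x = x \<cdot> y\<close>.\<close>
  also have "\<dots> = x \<cdot> y"
    using assms(1,2) by (simp add: idem mult_mult_right_self)
  finally show ?thesis .
qed

lemma (in ag_band) if_12_ideal_imp_right_ideal:
  assumes "if_12_ideal \<mu> \<gamma>"
  shows "if_right_ideal \<mu> \<gamma>"
proof -
  have ifs: "intuitionistic_fuzzy_set S \<mu> \<gamma>"
    using assms by (simp add: if_12_ideal_def if_ag_subgroupoid_def)
  have twelve: "Min {\<mu> x, \<mu> y, \<mu> z} \<le> \<mu> ((x \<cdot> w) \<cdot> (y \<cdot> z)) \<and>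
      \<gamma> ((x \<cdot> w) \<cdot> (y \<cdot> z)) \<le> Max {\<gamma> x, \<gamma> y, \<gamma> z}"
    if "x \<in> S" "w \<in> S" "y \<in> S" "z \<in> S" for x w y z
    using assms that unfolding if_12_ideal_def by blast
  have "\<mu> x \<le> \<mu> (x \<cdot> y) \<and> \<gamma> (x \<cdot> y) \<le> \<gamma> x" if xy: "x \<in> S" "y \<in> S" for x y
  proof -
    \<comment> \<open>The last factor is kept as \<open>x \<cdot> x\<close> so that \<open>p\<close>
      has the shape \<open>(x \<cdot> w) \<cdot> (y \<cdot> z)\<close> of the (1,2)-condition:
      \<open>y\<close> fills the slot \<open>w\<close>, which is absent from the bounds, and
      \<open>x\<close> fills the other three.\<close>
    define p where "p = (x \<cdot> y) \<cdot> (x \<cdot> x)"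
    have p: "p \<in> S"
      using xy by (simp add: p_def closed)
    have "\<mu> x \<le> \<mu> p \<and> \<gamma> p \<le> \<gamma> x"
      using twelve[of x y x x] xy by (simp add: p_def)
    \<comment> \<open>Again \<open>y\<close> fills the slot \<open>w\<close>, so only degrees of
      \<open>p\<close> and \<open>x\<close> enter, and those of \<open>p\<close> are already bounded
      by those of \<open>x\<close>.\<close>
    moreover have "Min {\<mu> p, \<mu> p, \<mu> x} \<le> \<mu> (x \<cdot> y) \<and> \<gamma> (x \<cdot> y) \<le> Max {\<gamma> p, \<gamma> p, \<gamma> x}"
      using twelve[of p y p x] xy p mult_eq_12_product[of x y] by (simp add: p_def)
    ultimately show ?thesis
      by auto
  qed
  with ifs show ?thesis
    by (simp add: if_right_ideal_def)
qed

theorem theorem9: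
  fixes S :: "'a set" and mult :: "'a \<Rightarrow> 'a \<Rightarrow> 'a" and \<mu> \<gamma> :: "'a \<Rightarrow> real"
  assumes "regular_ag_band S mult"
    and "intuitionistic_fuzzy_set S \<mu> \<gamma>"
    and "ag_groupoid.if_12_ideal S mult \<mu> \<gamma>"
  shows "ag_groupoid.if_right_ideal S mult \<mu> \<gamma>"
proof -
  interpret regular_ag_band S mult by fact
  show ?thesis
    using assms(3) by (rule if_12_ideal_imp_right_ideal)
qed

end
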